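(* Let $T>0$, let $(\bar\rho,\bar\phi)$ be a smooth Euler solution on $[0,T]$, and for small $\varepsilon>0$ let $(\rho_s^\varepsilon,\psi_s^\varepsilon)$ be the prepared smooth (strong) semigeostrophic branch on $[0,T]$, with physical potential $P_s^\varepsilon=\frac{|x|^2}2+\varepsilon\psi_s^\varepsilon$. Assume that the prepared strong branch satisfies $$\|\nabla\psi_s^\varepsilon(t)-\nabla\bar\phi(t)\|_{L^2}\le C_T\varepsilon\qquad\text{for }0\le t\le T.$$ Let $(\widetilde\rho^\varepsilon,\widetilde\psi^\varepsilon)$ be a weak or Lagrangian semigeostrophic solution, with physical potential $\widetilde P^\varepsilon=\frac{|x|^2}2+\varepsilon\widetilde\psi^\varepsilon$, satisfying relative to the strong branch the weak--strong estimate $$\|\nabla\widetilde P^\varepsilon(t)-\nabla P_s^\varepsilon(t)\|_{L^2}\le C_T\|\nabla\widetilde P^\varepsilon(0)-\nabla P_s^\varepsilon(0)\|_{L^2}\qquad\text{for }0\le t\le T.$$ If the initial physical potentials are prepared so that $$\|\nabla\widetilde P^\varepsilon(0)-\nabla P_s^\varepsilon(0)\|_{L^2}\le C\varepsilon^2,$$ then $$\|\nabla\widetilde\psi^\varepsilon(t)-\nabla\bar\phi(t)\|_{L^2}\le C_T\varepsilon\qquad\text{for }0\le t\le T.$$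
   Context: $\mathbb{T}^2=\mathbb{R}^2/\mathbb{Z}^2$ with unit volume; $\nabla^\perp f=(-\partial_2f,\partial_1f)$, $\{f,g\}=\nabla^\perp f\cdot\nabla g$; all norms are over $\mathbb{T}^2$. Euler solution: $\partial_t\bar\rho+\{\bar\phi,\bar\rho\}=0$, $\Delta\bar\phi=\bar\rho$, with $\bar\rho,\bar\phi$ of zero mean. Scaled semigeostrophic system: $\partial_t\rho+\{\psi,\rho\}=0$, $\det(I+\varepsilon D^2\psi)=1+\varepsilon\rho$, with $\rho,\psi$ of zero mean; for a weak or Lagrangian solution the transport equation is understood in the weak/Lagrangian sense and $P=\frac{|x|^2}{2}+\varepsilon\psi$ is the convex periodic optimal-transport potential (polar factor) whose gradient pushes $(1+\varepsilon\rho)dx$ to $dx$. The prepared smooth branch is the smooth solution of this system whose initial datum is (canonically) $\rho_s^\varepsilon(0)=\bar\rho(0)$, with $\psi_s^\varepsilon(0)$ obtained from the Monge--Ampère equation. The constants $C,C_T$ are independent of $\varepsilon$; the value of $C_T$ may differ between occurrences (the final one depending only on the constants in the hypotheses). *)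

theory Defs
  imports "HOL-Analysis.Analysis"
begin

text \<open>
  Functions on the torus \<open>R^2/Z^2\<close> are represented by their \<open>Z^2\<close>-periodic lifts to \<^typ>\<open>real^2\<close>;
  integrals over the torus are Lebesgue integrals over the unit cell.
\<close>

definition torus_periodic :: "(real^2 \<Rightarrow> 'b) \<Rightarrow> bool" where
  "torus_periodic f \<longleftrightarrow> (\<forall>i x. f (x + axis i 1) = f x)"

abbreviation torus_cell :: "(real^2) set" where
  "torus_cell \<equiv> cbox 0 1"

abbreviation torus_measure :: "(real^2) measure" where
  "torus_measure \<equiv> lebesgue_on torus_cell"

definition torus_integral :: "(real^2 \<Rightarrow> real) \<Rightarrow> real" where
  "torus_integral f = (LINT x|torus_measure. f x)"

text \<open>
  The Bochner integral is \<open>0\<close> on non-integrable functions. This is harmless here: the norm is only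
  applied to differences of gradients of smooth periodic functions and of potentials \<open>P\<close> with \<open>P\<close>
  convex and \<open>P - |x|^2/2\<close> periodic, and for the latter \<open>\<nabla>P - x\<close> is measurable with
  components bounded by \<open>1/2\<close>.
\<close>

definition torus_L2_norm :: "(real^2 \<Rightarrow> real^2) \<Rightarrow> real" where
  "torus_L2_norm F = sqrt (torus_integral (\<lambda>x. (norm (F x))\<^sup>2))"

definition zero_mean :: "(real^2 \<Rightarrow> real) \<Rightarrow> bool" where
  "zero_mean f \<longleftrightarrow> integrable torus_measure f \<and> torus_integral f = 0"

text \<open>
  On a convex set with nonempty interior the derivative within the set is unique, so this is the
  class \<open>C^k\<close> up to the boundary.
\<close>

fun Ck_on :: "nat \<Rightarrow> 'a::euclidean_space set \<Rightarrow> ('a \<Rightarrow> real) \<Rightarrow> bool" where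
  "Ck_on 0 S f \<longleftrightarrow> continuous_on S f"
| "Ck_on (Suc k) S f \<longleftrightarrow>
     (\<exists>f'. (\<forall>x\<in>S. (f has_derivative f' x) (at x within S)) \<and>
           (\<forall>v\<in>Basis. Ck_on k S (\<lambda>x. f' x v)))"

definition smooth_on :: "'a::euclidean_space set \<Rightarrow> ('a \<Rightarrow> real) \<Rightarrow> bool" where
  "smooth_on S f \<longleftrightarrow> (\<forall>k. Ck_on k S f)"

definition smooth_torus_path :: "real \<Rightarrow> (real \<Rightarrow> real^2 \<Rightarrow> real) \<Rightarrow> bool" where
  "smooth_torus_path T f \<longleftrightarrow>
     smooth_on ({0..T} \<times> UNIV) (\<lambda>(t, x). f t x) \<and> (\<forall>t\<in>{0..T}. torus_periodic (f t))"

definition partial :: "2 \<Rightarrow> (real^2 \<Rightarrow> real) \<Rightarrow> real^2 \<Rightarrow> real" where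
  "partial i f x = frechet_derivative f (at x) (axis i 1)"

text \<open>
  At points where \<open>f\<close> is not differentiable the value is unspecified; convex functions are
  differentiable almost everywhere.
\<close>

definition grad :: "(real^2 \<Rightarrow> real) \<Rightarrow> real^2 \<Rightarrow> real^2" where
  "grad f x = (\<chi> i. partial i f x)"

definition grad_perp :: "(real^2 \<Rightarrow> real) \<Rightarrow> real^2 \<Rightarrow> real^2" where
  "grad_perp f x = vector [- partial 2 f x, partial 1 f x]"

definition bracket :: "(real^2 \<Rightarrow> real) \<Rightarrow> (real^2 \<Rightarrow> real) \<Rightarrow> real^2 \<Rightarrow> real" where
  "bracket f g x = grad_perp f x \<bullet> grad g x"

definition hessian :: "(real^2 \<Rightarrow> real) \<Rightarrow> real^2 \<Rightarrow> real^2^2" where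
  "hessian f x = (\<chi> i j. partial i (partial j f) x)"

definition laplacian :: "(real^2 \<Rightarrow> real) \<Rightarrow> real^2 \<Rightarrow> real" where
  "laplacian f x = (\<Sum>i\<in>UNIV. partial i (partial i f) x)"

definition classical_transport ::
  "real \<Rightarrow> (real \<Rightarrow> real^2 \<Rightarrow> real) \<Rightarrow> (real \<Rightarrow> real^2 \<Rightarrow> real) \<Rightarrow> bool" where
  "classical_transport T \<psi> \<rho> \<longleftrightarrow>
     (\<forall>t\<in>{0..T}. \<forall>x.
        ((\<lambda>s. \<rho> s x) has_real_derivative - bracket (\<psi> t) (\<rho> t) x) (at t within {0..T}))"

definition euler_solution ::
  "real \<Rightarrow> (real \<Rightarrow> real^2 \<Rightarrow> real) \<Rightarrow> (real \<Rightarrow> real^2 \<Rightarrow> real) \<Rightarrow> bool" where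
  "euler_solution T \<rho> \<phi> \<longleftrightarrow>
     smooth_torus_path T \<rho> \<and> smooth_torus_path T \<phi> \<and>
     (\<forall>t\<in>{0..T}. zero_mean (\<rho> t) \<and> zero_mean (\<phi> t)) \<and>
     classical_transport T \<phi> \<rho> \<and>
     (\<forall>t\<in>{0..T}. \<forall>x. laplacian (\<phi> t) x = \<rho> t x)"

definition sg_smooth_solution ::
  "real \<Rightarrow> real \<Rightarrow> (real \<Rightarrow> real^2 \<Rightarrow> real) \<Rightarrow> (real \<Rightarrow> real^2 \<Rightarrow> real) \<Rightarrow> bool" where
  "sg_smooth_solution \<epsilon> T \<rho> \<psi> \<longleftrightarrow>
     smooth_torus_path T \<rho> \<and> smooth_torus_path T \<psi> \<and>
     (\<forall>t\<in>{0..T}. zero_mean (\<rho> t) \<and> zero_mean (\<psi> t)) \<and>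
     classical_transport T \<psi> \<rho> \<and>
     (\<forall>t\<in>{0..T}. \<forall>x. det (mat 1 + \<epsilon> *\<^sub>R hessian (\<psi> t) x) = 1 + \<epsilon> * \<rho> t x)"

text \<open>
  The Monge--Ampere equation at time \<open>0\<close>, which determines \<open>\<psi> 0\<close>, is part of
  \<^const>\<open>sg_smooth_solution\<close>.
\<close>

definition sg_prepared_branch ::
  "real \<Rightarrow> real \<Rightarrow> (real^2 \<Rightarrow> real) \<Rightarrow> (real \<Rightarrow> real^2 \<Rightarrow> real) \<Rightarrow> (real \<Rightarrow> real^2 \<Rightarrow> real) \<Rightarrow> bool" where
  "sg_prepared_branch \<epsilon> T \<rho>0 \<rho> \<psi> \<longleftrightarrow> sg_smooth_solution \<epsilon> T \<rho> \<psi> \<and> \<rho> 0 = \<rho>0"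

definition physical_potential :: "real \<Rightarrow> (real^2 \<Rightarrow> real) \<Rightarrow> real^2 \<Rightarrow> real" where
  "physical_potential \<epsilon> \<psi> x = (norm x)\<^sup>2 / 2 + \<epsilon> * \<psi> x"

text \<open>
  \<open>F\<close> is the lift of a torus map; it pushes \<open>f dx\<close> to \<open>dx\<close> on the torus, tested against
  continuous periodic functions.
\<close>

definition torus_pushes_to_volume :: "(real^2 \<Rightarrow> real) \<Rightarrow> (real^2 \<Rightarrow> real^2) \<Rightarrow> bool" where
  "torus_pushes_to_volume f F \<longleftrightarrow>
     F \<in> borel_measurable torus_measure \<and>
     (\<forall>\<xi>. continuous_on UNIV \<xi> \<and> torus_periodic \<xi> \<longrightarrow>
        torus_integral (\<lambda>x. \<xi> (F x) * f x) = torus_integral \<xi>)"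

definition sg_polar_factor :: "real \<Rightarrow> (real^2 \<Rightarrow> real) \<Rightarrow> (real^2 \<Rightarrow> real) \<Rightarrow> bool" where
  "sg_polar_factor \<epsilon> \<rho> \<psi> \<longleftrightarrow>
     torus_periodic \<psi> \<and>
     convex_on UNIV (physical_potential \<epsilon> \<psi>) \<and>
     torus_pushes_to_volume (\<lambda>x. 1 + \<epsilon> * \<rho> x) (grad (physical_potential \<epsilon> \<psi>))"

definition sg_state :: "real \<Rightarrow> (real^2 \<Rightarrow> real) \<Rightarrow> (real^2 \<Rightarrow> real) \<Rightarrow> bool" where
  "sg_state \<epsilon> \<rho> \<psi> \<longleftrightarrow>
     torus_periodic \<rho> \<and> zero_mean \<rho> \<and> zero_mean \<psi> \<and>
     (AE x in torus_measure. 0 \<le> 1 + \<epsilon> * \<rho> x) \<and>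
     sg_polar_factor \<epsilon> \<rho> \<psi>"

text \<open>
  Distributional form of \<open>\<partial>\<^sub>t\<rho> + div (\<rho> \<nabla>\<^sup>\<bottom>\<psi>) = 0\<close> with initial value
  \<open>\<rho> 0\<close>, together with weak continuity in time, which gives a meaning to \<open>\<rho> t\<close> at every time.
\<close>

definition weak_transport ::
  "real \<Rightarrow> (real \<Rightarrow> real^2 \<Rightarrow> real) \<Rightarrow> (real \<Rightarrow> real^2 \<Rightarrow> real) \<Rightarrow> bool" where
  "weak_transport T \<psi> \<rho> \<longleftrightarrow>
     (\<forall>\<xi>. continuous_on UNIV \<xi> \<and> torus_periodic \<xi> \<longrightarrow>
        continuous_on {0..T} (\<lambda>t. torus_integral (\<lambda>x. \<rho> t x * \<xi> x))) \<and>
     set_integrable lebesgue ({0..T} \<times> torus_cell) (\<lambda>(t, x). \<rho> t x) \<and>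
     set_integrable lebesgue ({0..T} \<times> torus_cell) (\<lambda>(t, x). \<rho> t x *\<^sub>R grad_perp (\<psi> t) x) \<and>
     (\<forall>\<xi>. smooth_torus_path T \<xi> \<and> (\<exists>\<tau><T. \<forall>t\<in>{\<tau>..T}. \<forall>x. \<xi> t x = 0) \<longrightarrow>
        set_lebesgue_integral lebesgue ({0..T} \<times> torus_cell)
          (\<lambda>(t, x). \<rho> t x *
             (vector_derivative (\<lambda>s. \<xi> s x) (at t within {0..T}) + bracket (\<psi> t) (\<xi> t) x))
        + torus_integral (\<lambda>x. \<rho> 0 x * \<xi> 0 x) = 0)"

text \<open>
  \<open>\<rho>\<close> is constant along the trajectories of a measure-preserving (regular Lagrangian) flow \<open>X\<close>
  of \<open>\<nabla>\<^sup>\<bottom>\<psi>\<close>; \<open>X t\<close> is the lift of a torus map. The case \<open>t = 0\<close> of the integral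
  equation gives \<open>X 0 x = x\<close>.
\<close>

definition lagrangian_transport ::
  "real \<Rightarrow> (real \<Rightarrow> real^2 \<Rightarrow> real) \<Rightarrow> (real \<Rightarrow> real^2 \<Rightarrow> real) \<Rightarrow> bool" where
  "lagrangian_transport T \<psi> \<rho> \<longleftrightarrow>
     (\<exists>X :: real \<Rightarrow> real^2 \<Rightarrow> real^2.
        (\<forall>t\<in>{0..T}. \<forall>i x. X t (x + axis i 1) = X t x + axis i 1) \<and>
        (\<forall>t\<in>{0..T}. torus_pushes_to_volume (\<lambda>_. 1) (X t)) \<and>
        (AE x in torus_measure.
           set_integrable lebesgue {0..T} (\<lambda>s. grad_perp (\<psi> s) (X s x)) \<and>
           (\<forall>t\<in>{0..T}. X t x = x + (LINT s:{0..t}|lebesgue. grad_perp (\<psi> s) (X s x)))) \<and>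
        (\<forall>t\<in>{0..T}. AE x in torus_measure. \<rho> t (X t x) = \<rho> 0 x))"

definition sg_weak_solution ::
  "real \<Rightarrow> real \<Rightarrow> (real \<Rightarrow> real^2 \<Rightarrow> real) \<Rightarrow> (real \<Rightarrow> real^2 \<Rightarrow> real) \<Rightarrow> bool" where
  "sg_weak_solution \<epsilon> T \<rho> \<psi> \<longleftrightarrow>
     (\<forall>t\<in>{0..T}. sg_state \<epsilon> (\<rho> t) (\<psi> t)) \<and> weak_transport T \<psi> \<rho>"

definition sg_lagrangian_solution ::
  "real \<Rightarrow> real \<Rightarrow> (real \<Rightarrow> real^2 \<Rightarrow> real) \<Rightarrow> (real \<Rightarrow> real^2 \<Rightarrow> real) \<Rightarrow> bool" where
  "sg_lagrangian_solution \<epsilon> T \<rho> \<psi> \<longleftrightarrow>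
     (\<forall>t\<in>{0..T}. sg_state \<epsilon> (\<rho> t) (\<psi> t)) \<and> lagrangian_transport T \<psi> \<rho>"

end

theory Submission
  imports Defs
begin

text \<open>
  Since \<open>\<nabla>P = x + \<epsilon> \<nabla>\<psi>\<close>, the error of \<open>\<nabla>\<psi>\<close> is that of \<open>\<nabla>P\<close> divided by \<open>\<epsilon>\<close>, so an
  error of order \<open>\<epsilon>\<^sup>2\<close> between the physical gradients, propagated by the weak-strong estimate,
  costs only order \<open>\<epsilon>\<close>; the triangle inequality through the strong branch does the rest. The
  weak potential is only convex, so the pointwise identity relies on convex functions being
  differentiable almost everywhere: along a line the subgradients are monotone, so there are
  countably many kinks on it, and by Fubini the kinks in coordinate directions form a null set. The
  norms are genuine integrals because the gradient of a convex function is bounded on the unit cell.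
\<close>

section \<open>Almost everywhere differentiability of convex functions\<close>

lemma convex_on_real_subgradient:
  fixes f :: "real \<Rightarrow> real"
  assumes "convex_on UNIV f"
  shows "\<exists>r. \<forall>x y. f x + r x * (y - x) \<le> f y"
proof (intro exI allI)
  \<comment> \<open>The slope is the infimum of the forward difference quotients at
    \<open>x\<close>, that is, the right derivative.\<close>
  show "f x + Inf ((\<lambda>t. (f x - f t) / (x - t)) ` ({x<..} \<inter> UNIV)) * (y - x) \<le> f y" for x y
    using assms by (intro convex_le_Inf_differential) auto
qed

text \<open>For convex \<open>f\<close> the symmetric second difference divided by its step
  decreases with the step to the jump at \<open>x\<close> of the one-sided derivatives along
  \<open>e\<close>, so the points where this jump is positive are described. Discrete steps and
  thresholds leave only countable quantifiers, which keeps the set Borel for continuous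
  \<open>f\<close>.\<close>

definition kinks :: "('a::real_normed_vector \<Rightarrow> real) \<Rightarrow> 'a \<Rightarrow> 'a set" where
  "kinks f e = {x. \<exists>k. \<forall>n. inverse (Suc k) * inverse (Suc n) <
     f (x + inverse (Suc n) *\<^sub>R e) + f (x - inverse (Suc n) *\<^sub>R e) - 2 * f x}"

text \<open>A selection of subgradients is monotone and hence has countably many jumps.\<close>

lemma countable_kinks_real:
  fixes f :: "real \<Rightarrow> real"
  assumes "convex_on UNIV f"
  shows "countable (kinks f 1)"
proof -
  obtain r where r: "\<And>x y. f x + r x * (y - x) \<le> f y"
    using convex_on_real_subgradient[OF assms] by blast
  have "mono r"
  proof (rule monoI)
    fix x y :: real
    assume "x \<le> y"
    have "0 \<le> (r y - r x) * (y - x)"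
      using r[of x y] r[of y x] by (simp add: algebra_simps)
    with \<open>x \<le> y\<close> show "r x \<le> r y"
      by (cases "x = y") (auto simp: zero_le_mult_iff)
  qed
  have "\<not> isCont r t" if kink: "t \<in> kinks f 1" for t
  proof
    assume cont: "isCont r t"
    obtain k where k: "\<forall>n. inverse (Suc k) * inverse (Suc n) <
        f (t + inverse (Suc n)) + f (t - inverse (Suc n)) - 2 * f t"
      using kink by (auto simp: kinks_def)
    have "inverse (Suc k) \<le> r (t + inverse (Suc n)) - r (t - inverse (Suc n))" for n
    proof -
      \<comment> \<open>The subgradients at the two outer points, tested at \<open>t\<close>, bound
        the second difference by the step times the increment of \<open>r\<close>.\<close>
      have "f (t + inverse (Suc n)) + f (t - inverse (Suc n)) - 2 * f t
          \<le> (r (t + inverse (Suc n)) - r (t - inverse (Suc n))) * inverse (Suc n)"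
        using r[of "t + inverse (Suc n)" t] r[of "t - inverse (Suc n)" t]
        by (simp add: algebra_simps)
      with k have "inverse (Suc k) * inverse (Suc n)
          < (r (t + inverse (Suc n)) - r (t - inverse (Suc n))) * inverse (Suc n)"
        by (meson less_le_trans)
      then show ?thesis
        by (simp add: mult_less_cancel_right)
    qed
    \<comment> \<open>At a continuity point this increment tends to \<open>0\<close>, although it
      stays above \<open>inverse (Suc k)\<close>.\<close>
    moreover have "(\<lambda>n. r (t + inverse (Suc n)) - r (t - inverse (Suc n))) \<longlonglongrightarrow> r (t + 0) - r (t - 0)"
      by (intro tendsto_intros isCont_tendsto_compose[of _ r] LIMSEQ_inverse_real_of_nat)
        (use cont in auto)
    ultimately have "inverse (Suc k) \<le> r (t + 0) - r (t - 0)"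
      by (intro LIMSEQ_le_const) auto
    then show False
      by simp
  qed
  then have "kinks f 1 \<subseteq> {t. \<not> isCont r t}"
    by blast
  then show ?thesis
    using mono_ctble_discont[OF \<open>mono r\<close>] by (rule countable_subset)
qed

text \<open>
  By translation invariance the measure of \<open>N\<close> equals its average over the translates
  \<open>N - t e\<close> with \<open>t\<close> in the unit interval, which Tonelli's theorem computes along the lines first.
\<close>

lemma null_sets_lborel_if_countable_lines:
  fixes N :: "'a::euclidean_space set"
  assumes N: "N \<in> sets borel"
    and countable: "\<And>x. countable {t::real. x + t *\<^sub>R e \<in> N}"
  shows "N \<in> null_sets lborel"
proof -
  let ?g = "\<lambda>(t::real) x. indicator {0..1} t * indicator N (x + t *\<^sub>R e) :: ennreal"
  have meas: "case_prod ?g \<in> borel_measurable (lborel \<Otimes>\<^sub>M lborel)"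
    using N unfolding split_beta' by measurable
  have translate: "(\<integral>\<^sup>+x. indicator N (x + v) \<partial>lborel) = emeasure lborel N" for v :: 'a
  proof -
    have "emeasure lborel N = (\<integral>\<^sup>+x. indicator N x \<partial>distr lborel borel ((+) v))"
      using N by (simp add: lborel_distr_plus)
    also have "\<dots> = (\<integral>\<^sup>+x. indicator N (v + x) \<partial>lborel)"
      using N by (subst nn_integral_distr) auto
    finally show ?thesis
      by (simp add: add.commute)
  qed
  have "emeasure lborel N = (\<integral>\<^sup>+t. indicator {0..1::real} t * emeasure lborel N \<partial>lborel)"
    by (subst nn_integral_multc) auto
  also have "\<dots> = (\<integral>\<^sup>+t. \<integral>\<^sup>+x. ?g t x \<partial>lborel \<partial>lborel)"
  proof (rule nn_integral_cong)
    fix t :: real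
    have "(\<lambda>x::'a. indicator N (x + t *\<^sub>R e) :: ennreal) \<in> borel_measurable lborel"
      using N by measurable
    then show "indicator {0..1} t * emeasure lborel N = (\<integral>\<^sup>+x. ?g t x \<partial>lborel)"
      using translate[of "t *\<^sub>R e"] by (simp add: nn_integral_cmult)
  qed
  also have "\<dots> = (\<integral>\<^sup>+x. \<integral>\<^sup>+t. ?g t x \<partial>lborel \<partial>lborel)"
    using lborel_pair.Fubini'[OF meas] by simp
  also have "\<dots> = 0"
  proof -
    have "(\<integral>\<^sup>+t. ?g t x \<partial>lborel) = (\<integral>\<^sup>+t. 0 \<partial>(lborel :: real measure))" for x
    proof (rule nn_integral_cong_AE)
      show "AE t in lborel. ?g t x = 0"
        by (rule AE_I'[OF countable_imp_null_set_lborel[OF countable[of x]]])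
          (auto simp: indicator_def)
    qed
    then show ?thesis
      by simp
  qed
  finally show ?thesis
    using N by auto
qed

lemma convex_on_line:
  fixes f :: "'a::real_vector \<Rightarrow> real"
  assumes "convex_on UNIV f"
  shows "convex_on UNIV (\<lambda>t::real. f (x + t *\<^sub>R e))"
  unfolding convex_on_def
proof (intro conjI ballI allI impI)
  fix s t u v :: real
  assume uv: "0 \<le> u" "0 \<le> v" "u + v = 1"
  have "x + (u *\<^sub>R s + v *\<^sub>R t) *\<^sub>R e = (u + v) *\<^sub>R x + (u * s + v * t) *\<^sub>R e"
    using uv by simp
  also have "\<dots> = u *\<^sub>R (x + s *\<^sub>R e) + v *\<^sub>R (x + t *\<^sub>R e)"
    by (simp add: algebra_simps)
  finally show "f (x + (u *\<^sub>R s + v *\<^sub>R t) *\<^sub>R e) \<le> u * f (x + s *\<^sub>R e) + v * f (x + t *\<^sub>R e)"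
    using assms uv by (simp add: convex_on_def)
qed simp

text \<open>Convex functions on the whole space are continuous, which gives measurability. A line in
  direction \<open>e\<close> meets the set exactly in the kinks of the restriction of
  \<open>f\<close> to that line, and these are countable.\<close>

lemma kinks_null_set:
  fixes f :: "'a::euclidean_space \<Rightarrow> real"
  assumes f: "convex_on UNIV f"
  shows "kinks f e \<in> null_sets lborel"
proof (rule null_sets_lborel_if_countable_lines)
  have [measurable]: "f \<in> borel_measurable borel"
    using convex_on_continuous[OF open_UNIV f] by (rule borel_measurable_continuous_onI)
  have "{x \<in> space borel. \<exists>k. \<forall>n. inverse (Suc k) * inverse (Suc n) <
     f (x + inverse (Suc n) *\<^sub>R e) + f (x - inverse (Suc n) *\<^sub>R e) - 2 * f x} \<in> sets borel"
    by measurable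
  then show "kinks f e \<in> sets borel"
    by (simp add: kinks_def)
next
  fix x
  have "convex_on UNIV (\<lambda>t::real. f (x + t *\<^sub>R e))"
    using f by (rule convex_on_line)
  from countable_kinks_real[OF this] show "countable {t. x + t *\<^sub>R e \<in> kinks f e}"
    by (simp add: kinks_def algebra_simps)
qed

text \<open>
  Off the kinks the second differences of \<open>f\<close> along the basis vectors are \<open>o(h)\<close>. By convexity this
  bounds \<open>g y = f y - f x - v \<bullet> (y - x)\<close> above by a small multiple of the norm of \<open>y - x\<close>, and
  convexity at the midpoint \<open>x\<close> turns the upper bound into a lower one.
\<close>

lemma convex_differentiable_off_kinks:
  fixes f :: "'a::euclidean_space \<Rightarrow> real"
  assumes f: "convex_on UNIV f"
    and x: "\<And>b. b \<in> Basis \<Longrightarrow> x \<notin> kinks f b"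
  shows "f differentiable at x"
proof -
  have "\<exists>c. \<forall>t. f x + c * t \<le> f (x + t *\<^sub>R b)" for b
  proof -
    obtain r where "\<And>s t. f (x + s *\<^sub>R b) + r s * (t - s) \<le> f (x + t *\<^sub>R b)"
      using convex_on_real_subgradient[OF convex_on_line[OF f]] by blast
    from this[of 0] show ?thesis
      by auto
  qed
  then obtain c where c: "\<And>b t. f x + c b * t \<le> f (x + t *\<^sub>R b)"
    by metis
  \<comment> \<open>This is the candidate gradient. Its components are subgradient slopes along the
    basis vectors, so \<open>g\<close> is nonnegative on the coordinate axes.\<close>
  define v where "v = (\<Sum>b\<in>Basis. c b *\<^sub>R b)"
  define g where "g h = f (x + h) - f x - v \<bullet> h" for h
  have g0: "g 0 = 0"
    by (simp add: g_def)
  have g_convex: "convex_on UNIV g"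
    unfolding convex_on_def
  proof (intro conjI ballI allI impI)
    fix y z :: 'a and p q :: real
    assume pq: "0 \<le> p" "0 \<le> q" "p + q = 1"
    have "x + (p *\<^sub>R y + q *\<^sub>R z) = (p + q) *\<^sub>R x + (p *\<^sub>R y + q *\<^sub>R z)"
      using pq by simp
    also have "\<dots> = p *\<^sub>R (x + y) + q *\<^sub>R (x + z)"
      by (simp add: algebra_simps)
    finally have "f (x + (p *\<^sub>R y + q *\<^sub>R z)) \<le> p * f (x + y) + q * f (x + z)"
      using f pq by (simp add: convex_on_def)
    moreover have "f x = p * f x + q * f x"
      using pq by (metis distrib_right mult_1)
    ultimately show "g (p *\<^sub>R y + q *\<^sub>R z) \<le> p * g y + q * g z"
      by (simp add: g_def algebra_simps)
  qed simp
  have g_basis: "0 \<le> g (t *\<^sub>R b)" if "b \<in> Basis" for b t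
  proof -
    have "v \<bullet> b = c b"
      using that by (simp add: v_def inner_sum_left_Basis)
    then show ?thesis
      using c[of b t] by (simp add: g_def algebra_simps)
  qed
  have small: "\<exists>\<eta>>0. \<forall>t. \<bar>t\<bar> \<le> \<eta> \<longrightarrow> g (t *\<^sub>R b) \<le> \<delta> * \<bar>t\<bar>" if "b \<in> Basis" "\<delta> > 0" for b \<delta>
  proof -
    obtain k where k: "inverse (Suc k) < \<delta>"
      using reals_Archimedean[OF \<open>\<delta> > 0\<close>] by auto
    obtain n where n: "f (x + inverse (Suc n) *\<^sub>R b) + f (x - inverse (Suc n) *\<^sub>R b) - 2 * f x
        \<le> inverse (Suc k) * inverse (Suc n)"
      using x[OF \<open>b \<in> Basis\<close>] by (auto simp: kinks_def not_less)
    define \<eta> :: real where "\<eta> = inverse (Suc n)"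
    have "\<eta> > 0"
      by (simp add: \<eta>_def)
    have "g (\<eta> *\<^sub>R b) + g ((-\<eta>) *\<^sub>R b) \<le> inverse (Suc k) * \<eta>"
      using n by (simp add: g_def \<eta>_def)
    also have "\<dots> \<le> \<delta> * \<eta>"
      using k \<open>\<eta> > 0\<close> by (intro mult_right_mono) auto
    \<comment> \<open>Both summands are nonnegative, so each is bounded by the sum.\<close>
    finally have end1: "g (\<eta> *\<^sub>R b) \<le> \<delta> * \<eta>" and end2: "g ((-\<eta>) *\<^sub>R b) \<le> \<delta> * \<eta>"
      using g_basis[OF \<open>b \<in> Basis\<close>, of \<eta>] g_basis[OF \<open>b \<in> Basis\<close>, of "-\<eta>"] by linarith+
    have "g (t *\<^sub>R b) \<le> \<delta> * \<bar>t\<bar>" if "\<bar>t\<bar> \<le> \<eta>" for t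
    proof -
      \<comment> \<open>For \<open>t\<close> other than \<open>0\<close> this is the endpoint on the
        side of \<open>t\<close>. Convexity and \<open>g 0 = 0\<close> carry the bound from the
        single step \<open>\<eta>\<close> to all smaller ones, so one good \<open>n\<close>
        suffices.\<close>
      define s where "s = sgn t * \<eta>"
      have "g ((1 - \<bar>t\<bar> / \<eta>) *\<^sub>R 0 + (\<bar>t\<bar> / \<eta>) *\<^sub>R (s *\<^sub>R b))
          \<le> (1 - \<bar>t\<bar> / \<eta>) * g 0 + (\<bar>t\<bar> / \<eta>) * g (s *\<^sub>R b)"
        using that \<open>\<eta> > 0\<close> by (intro convex_onD[OF g_convex]) auto
      moreover have "\<bar>t\<bar> / \<eta> * s = t"
        using \<open>\<eta> > 0\<close> by (simp add: s_def abs_mult_sgn)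
      moreover have "g (s *\<^sub>R b) \<le> \<delta> * \<eta>"
        using end1 end2 g0 \<open>\<eta> > 0\<close> \<open>\<delta> > 0\<close> by (cases t "0::real" rule: linorder_cases) (auto simp: s_def)
      then have "(\<bar>t\<bar> / \<eta>) * g (s *\<^sub>R b) \<le> (\<bar>t\<bar> / \<eta>) * (\<delta> * \<eta>)"
        using \<open>\<eta> > 0\<close> by (intro mult_left_mono) auto
      ultimately show ?thesis
        using \<open>\<eta> > 0\<close> g0 by (simp add: mult.commute)
    qed
    with \<open>\<eta> > 0\<close> show ?thesis
      by blast
  qed
  let ?n = "real DIM('a)"
  have upper: "\<exists>\<eta>>0. \<forall>h. norm h \<le> \<eta> \<longrightarrow> g h \<le> \<delta> * norm h" if "\<delta> > 0" for \<delta>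
  proof -
    have "\<forall>b\<in>Basis. \<exists>\<eta>>0. \<forall>t. \<bar>t\<bar> \<le> \<eta> \<longrightarrow> g (t *\<^sub>R b) \<le> \<delta> / ?n * \<bar>t\<bar>"
      using that by (intro ballI small) auto
    then obtain \<eta>' where \<eta>': "\<And>b. b \<in> Basis \<Longrightarrow> \<eta>' b > 0"
      "\<And>b t. b \<in> Basis \<Longrightarrow> \<bar>t\<bar> \<le> \<eta>' b \<Longrightarrow> g (t *\<^sub>R b) \<le> \<delta> / ?n * \<bar>t\<bar>"
      by metis
    define \<eta> where "\<eta> = Min (\<eta>' ` Basis) / ?n"
    have "\<eta> > 0"
      using \<eta>'(1) by (simp add: \<eta>_def)
    have "g h \<le> \<delta> * norm h" if h: "norm h \<le> \<eta>" for h
    proof -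
      \<comment> \<open>The vector \<open>h\<close> is the average of its coordinate parts stretched
        by \<open>?n\<close>, so Jensen's inequality reduces the bound to the axes. The stretching
        explains the divisions by \<open>?n\<close> in \<open>\<eta>\<close> and in the slope
        \<open>\<delta> / ?n\<close>.\<close>
      have "g h = g (\<Sum>b\<in>Basis. (1 / ?n) *\<^sub>R (?n * (h \<bullet> b)) *\<^sub>R b)"
        by (simp add: euclidean_representation)
      also have "\<dots> \<le> (\<Sum>b\<in>Basis. (1 / ?n) * g ((?n * (h \<bullet> b)) *\<^sub>R b))"
        by (rule convex_on_sum[OF _ _ g_convex]) auto
      also have "\<dots> \<le> (\<Sum>b\<in>(Basis::'a set). (1 / ?n) * (\<delta> * norm h))"
      proof (intro sum_mono mult_left_mono)
        fix b :: 'a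
        assume b: "b \<in> Basis"
        have hb: "\<bar>h \<bullet> b\<bar> \<le> norm h"
          using b by (rule Basis_le_norm)
        have "?n * \<bar>h \<bullet> b\<bar> \<le> ?n * \<eta>"
          using hb h by (intro mult_left_mono) auto
        also have "\<dots> \<le> \<eta>' b"
          using b by (simp add: \<eta>_def)
        finally have "\<bar>?n * (h \<bullet> b)\<bar> \<le> \<eta>' b"
          by (simp add: abs_mult)
        from \<eta>'(2)[OF b this] have "g ((?n * (h \<bullet> b)) *\<^sub>R b) \<le> \<delta> * \<bar>h \<bullet> b\<bar>"
          by (simp add: abs_mult)
        also have "\<dots> \<le> \<delta> * norm h"
          using hb \<open>\<delta> > 0\<close> by simp
        finally show "g ((?n * (h \<bullet> b)) *\<^sub>R b) \<le> \<delta> * norm h" .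
      qed simp
      finally show ?thesis
        by simp
    qed
    with \<open>\<eta> > 0\<close> show ?thesis
      by blast
  qed
  have "(f has_derivative (\<lambda>h. v \<bullet> h)) (at x)"
    unfolding has_derivative_at_alt
  proof (intro conjI allI impI)
    show "bounded_linear (\<lambda>h. v \<bullet> h)"
      by (rule bounded_linear_inner_right)
    fix \<delta> :: real
    assume "\<delta> > 0"
    then obtain \<eta> where \<eta>: "\<eta> > 0" "\<And>h. norm h \<le> \<eta> \<Longrightarrow> g h \<le> \<delta> * norm h"
      using upper by blast
    have "\<bar>g h\<bar> \<le> \<delta> * norm h" if "norm h \<le> \<eta>" for h
    proof -
      have "g ((1/2) *\<^sub>R h + (1/2) *\<^sub>R (- h)) \<le> (1/2) * g h + (1/2) * g (- h)"
        using g_convex unfolding convex_on_def by (metis UNIV_I field_sum_of_halves half_gt_zero less_eq_real_def zero_less_one)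
      then show ?thesis
        using \<eta>(2)[of h] \<eta>(2)[of "- h"] that g0 by simp
    qed
    then have "norm (f y - f x - v \<bullet> (y - x)) \<le> \<delta> * norm (y - x)" if "norm (y - x) < \<eta>" for y
      using that by (fastforce simp: g_def dest: spec[of _ "y - x"])
    with \<eta>(1) show "\<exists>d>0. \<forall>y. norm (y - x) < d \<longrightarrow> norm (f y - f x - v \<bullet> (y - x)) \<le> \<delta> * norm (y - x)"
      by blast
  qed
  then show ?thesis
    by (auto simp: differentiable_def)
qed

lemma convex_AE_differentiable:
  fixes f :: "'a::euclidean_space \<Rightarrow> real"
  assumes "convex_on UNIV f"
  shows "AE x in lborel. f differentiable at x"
proof -
  have "AE x in lborel. \<forall>b\<in>Basis. x \<notin> kinks f b"
    by (subst AE_finite_all) (auto intro: AE_not_in kinks_null_set assms)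
  then show ?thesis
    using convex_differentiable_off_kinks[OF assms] by auto
qed

text \<open>On the line through \<open>x\<close> in direction \<open>v\<close> this is the
  one-variable tangent inequality at \<open>0\<close>, evaluated at \<open>1\<close>. It lets values
  of \<open>f\<close> control its gradient.\<close>

lemma convex_derivative_le_difference:
  fixes f :: "'a::real_normed_vector \<Rightarrow> real"
  assumes f: "convex_on UNIV f" and D: "(f has_derivative D) (at x)"
  shows "D v \<le> f (x + v) - f x"
proof -
  have "((\<lambda>t::real. x + t *\<^sub>R v) has_derivative (\<lambda>t. t *\<^sub>R v)) (at 0)"
    by (auto intro!: derivative_eq_intros)
  moreover have "(f has_derivative D) (at (x + (0::real) *\<^sub>R v))"
    using D by simp
  ultimately have "((\<lambda>t::real. f (x + t *\<^sub>R v)) has_derivative (\<lambda>t. D (t *\<^sub>R v))) (at 0)"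
    by (rule has_derivative_compose)
  moreover have "(\<lambda>t. D (t *\<^sub>R v)) = (*) (D v)"
    using has_derivative_linear[OF D] by (auto simp: linear_scale)
  ultimately have "((\<lambda>t::real. f (x + t *\<^sub>R v)) has_real_derivative D v) (at 0)"
    by (simp add: has_field_derivative_def)
  from convex_on_imp_above_tangent[OF convex_on_line[OF f] connected_UNIV _ UNIV_I this, of 1]
  show ?thesis
    by simp
qed

section \<open>Gradients of physical potentials, smooth paths and convex functions\<close>

lemma grad_eq:
  assumes "(f has_derivative D) (at x)"
  shows "grad f x = (\<chi> i. D (axis i 1))"
  using frechet_derivative_at[OF assms] by (simp add: grad_def partial_def vec_eq_iff)

lemma physical_potential_has_derivative:
  assumes "(\<psi> has_derivative D) (at x)"
  shows "(physical_potential \<epsilon> \<psi> has_derivative (\<lambda>h. x \<bullet> h + \<epsilon> * D h)) (at x)"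
proof -
  have "physical_potential \<epsilon> \<psi> = (\<lambda>x. (x \<bullet> x) / 2 + \<epsilon> * \<psi> x)"
    by (auto simp: physical_potential_def power2_norm_eq_inner)
  then show ?thesis
    using assms by (auto intro!: derivative_eq_intros simp: inner_commute)
qed

lemma grad_physical_potential:
  assumes "\<psi> differentiable (at x)"
  shows "grad (physical_potential \<epsilon> \<psi>) x = x + \<epsilon> *\<^sub>R grad \<psi> x"
proof -
  obtain D where D: "(\<psi> has_derivative D) (at x)"
    using assms by (auto simp: differentiable_def)
  show ?thesis
    using grad_eq[OF D] grad_eq[OF physical_potential_has_derivative[OF D, of \<epsilon>]]
    by (simp add: vec_eq_iff inner_axis)
qed

text \<open>Convexity yields differentiability only of the physical potential; subtracting the
  quadratic part and dividing by \<open>\<epsilon>\<close> passes it on to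
  \<open>\<psi>\<close>.\<close>

lemma differentiable_if_physical_potential_differentiable:
  assumes "\<epsilon> \<noteq> 0" and "physical_potential \<epsilon> \<psi> differentiable (at x)"
  shows "\<psi> differentiable (at x)"
proof -
  have "\<psi> = (\<lambda>x. (physical_potential \<epsilon> \<psi> x - (x \<bullet> x) / 2) / \<epsilon>)"
    using assms(1) by (auto simp: physical_potential_def power2_norm_eq_inner)
  moreover have "(\<lambda>x. (physical_potential \<epsilon> \<psi> x - (x \<bullet> x) / 2) / \<epsilon>) differentiable (at x)"
  proof -
    obtain D where "(physical_potential \<epsilon> \<psi> has_derivative D) (at x)"
      using assms(2) by (auto simp: differentiable_def)
    then have "((\<lambda>x. (physical_potential \<epsilon> \<psi> x - (x \<bullet> x) / 2) / \<epsilon>) has_derivative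
        (\<lambda>h. (D h - (x \<bullet> h + h \<bullet> x) / 2) / \<epsilon>)) (at x)"
      using assms(1) by (auto intro!: derivative_eq_intros)
    then show ?thesis
      by (auto simp: differentiable_def)
  qed
  ultimately show ?thesis
    by simp
qed

lemma AE_torus_measure_if_AE_lborel:
  "(AE x in lborel. P x) \<Longrightarrow> (AE x in torus_measure. P x)"
  by (subst AE_restrict_space_iff) (auto dest: AE_completion)

text \<open>Smoothness is joint in time and space and one-sided at the end times. The slice at time
  \<open>t\<close> lies inside the strip, so the chain rule along \<open>y \<mapsto> (t, y)\<close>
  still gives a full spatial derivative there.\<close>

lemma smooth_torus_path_slice:
  assumes "smooth_torus_path T f" and t: "t \<in> {0..T}"
  shows "f t differentiable (at x)" and "continuous_on UNIV (grad (f t))"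
proof -
  have "Ck_on (Suc 0) ({0..T} \<times> UNIV) (\<lambda>(t, x). f t x)"
    using assms by (auto simp: smooth_torus_path_def smooth_on_def)
  then obtain f' where
    f': "\<And>s y. s \<in> {0..T} \<Longrightarrow>
      ((\<lambda>(t, x). f t x) has_derivative f' (s, y)) (at (s, y) within {0..T} \<times> UNIV)" and
    cont: "\<And>v. v \<in> Basis \<Longrightarrow> continuous_on ({0..T} \<times> UNIV) (\<lambda>p. f' p v)"
    unfolding Ck_on.simps by blast
  have deriv: "(f t has_derivative (\<lambda>h. f' (t, y) (0, h))) (at y)" for y
  proof -
    have "((\<lambda>y. (t, y)) has_derivative (\<lambda>h. (0, h))) (at y)"
      by (auto intro!: derivative_eq_intros)
    moreover have "((\<lambda>(t, x). f t x) has_derivative f' (t, y)) (at (t, y) within range (\<lambda>y. (t, y)))"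
      by (rule has_derivative_subset[OF f'[OF t]]) (use t in auto)
    ultimately have "((\<lambda>(t, x). f t x) \<circ> (\<lambda>y. (t, y)) has_derivative f' (t, y) \<circ> (\<lambda>h. (0, h))) (at y)"
      by (rule diff_chain_within)
    then show ?thesis
      by (simp add: o_def)
  qed
  then show "f t differentiable (at x)"
    by (auto simp: differentiable_def)
  have "continuous_on UNIV (\<lambda>y. f' (t, y) (0, axis i 1))" for i
  proof (rule continuous_on_compose2[OF cont])
    show "(0, axis i 1) \<in> (Basis :: (real \<times> (real^2)) set)"
      by (auto simp: Basis_prod_def axis_in_Basis_iff)
  qed (use t in \<open>auto intro!: continuous_intros\<close>)
  then show "continuous_on UNIV (grad (f t))"
    using grad_eq[OF deriv] by (simp add: continuous_on_vec_lambda cong: continuous_on_cong)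
qed

text \<open>The tangent inequality in the directions \<open>axis i 1\<close> and
  \<open>- axis i 1\<close> encloses each partial derivative between differences of values of
  \<open>f\<close>, and these are bounded on the compact cell by continuity.\<close>

lemma convex_grad_bounded:
  assumes f: "convex_on UNIV f"
  obtains M where "\<And>x. x \<in> torus_cell \<Longrightarrow> f differentiable (at x) \<Longrightarrow> norm (grad f x) \<le> M"
proof -
  have cont: "continuous_on UNIV f"
    using convex_on_continuous[OF open_UNIV f] .
  have bdd: "\<exists>B. \<forall>x\<in>torus_cell. \<bar>f (x + v) - f x\<bar> \<le> B" for v
  proof -
    have "continuous_on torus_cell (\<lambda>x. f (x + v) - f x)"
      by (intro continuous_intros continuous_on_compose2[OF cont]) auto
    from compact_imp_bounded[OF compact_continuous_image[OF this compact_cbox]]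
    show ?thesis
      by (auto simp: bounded_iff)
  qed
  then obtain B where B: "\<And>v x. x \<in> torus_cell \<Longrightarrow> \<bar>f (x + v) - f x\<bar> \<le> B v"
    by metis
  have "norm (grad f x) \<le> (\<Sum>i\<in>UNIV. B (axis i 1) + B (- axis i 1))"
    if x: "x \<in> torus_cell" and "f differentiable (at x)" for x
  proof -
    obtain D where D: "(f has_derivative D) (at x)"
      using \<open>f differentiable (at x)\<close> unfolding differentiable_def by blast
    have "norm (grad f x) \<le> (\<Sum>i\<in>UNIV. \<bar>D (axis i 1)\<bar>)"
      using norm_le_l1_cart[of "grad f x"] by (simp add: grad_eq[OF D])
    also have "\<dots> \<le> (\<Sum>i\<in>UNIV. B (axis i 1) + B (- axis i 1))"
    proof (rule sum_mono)
      fix i :: 2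
      have "D (- axis i 1) = - D (axis i 1)"
        using has_derivative_linear[OF D] by (rule linear_neg)
      then show "\<bar>D (axis i 1)\<bar> \<le> B (axis i 1) + B (- axis i 1)"
        using convex_derivative_le_difference[OF f D, of "axis i 1"]
          convex_derivative_le_difference[OF f D, of "- axis i 1"]
          B[OF x, of "axis i 1"] B[OF x, of "- axis i 1"] by linarith
    qed
    finally show ?thesis .
  qed
  then show thesis
    by (rule that)
qed

section \<open>Square integrability on the unit cell\<close>

lemma finite_measure_torus: "finite_measure torus_measure"
  by (rule finite_measure_lebesgue_on) auto

lemma borel_measurable_torus_continuous:
  fixes F :: "real^2 \<Rightarrow> real^2"
  assumes "continuous_on UNIV F"
  shows "F \<in> borel_measurable torus_measure"
  using assms by (intro continuous_imp_measurable_on_sets_lebesgue) (auto intro: continuous_on_subset)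

lemma torus_integrable_norm_square:
  assumes "F \<in> borel_measurable torus_measure" and "AE x in torus_measure. norm (F x) \<le> M"
  shows "integrable torus_measure (\<lambda>x. (norm (F x))\<^sup>2)"
proof (rule finite_measure.integrable_const_bound[OF finite_measure_torus, where B = "M\<^sup>2"])
  show "AE x in torus_measure. norm ((norm (F x))\<^sup>2) \<le> M\<^sup>2"
    using assms(2) by eventually_elim (simp add: power_mono)
  show "(\<lambda>x. (norm (F x))\<^sup>2) \<in> borel_measurable torus_measure"
    using assms(1) by measurable
qed

lemma continuous_bounded_on_torus_cell:
  fixes F :: "real^2 \<Rightarrow> real^2"
  assumes "continuous_on UNIV F"
  obtains M where "\<And>x. x \<in> torus_cell \<Longrightarrow> norm (F x) \<le> M"
proof -
  have "bounded (F ` torus_cell)"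
    using assms by (intro compact_imp_bounded compact_continuous_image)
      (auto intro: continuous_on_subset)
  then show thesis
    using that by (auto simp: bounded_iff)
qed

section \<open>The L2 norm and the error estimate\<close>

lemma torus_L2_norm_nonneg: "0 \<le> torus_L2_norm F"
  by (simp add: torus_L2_norm_def torus_integral_def)

lemma torus_L2_norm_square: "(torus_L2_norm F)\<^sup>2 = (LINT x|torus_measure. (norm (F x))\<^sup>2)"
  by (simp add: torus_L2_norm_def torus_integral_def)

text \<open>If \<open>H\<close> is not square integrable, then its norm is the junk value \<open>0\<close>.\<close>

lemma torus_L2_norm_quasi_triangle:
  assumes F: "integrable torus_measure (\<lambda>x. (norm (F x))\<^sup>2)"
    and G: "integrable torus_measure (\<lambda>x. (norm (G x))\<^sup>2)"
    and H: "AE x in torus_measure. H x = c *\<^sub>R F x + G x"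
  shows "torus_L2_norm H \<le> 2 * (\<bar>c\<bar> * torus_L2_norm F + torus_L2_norm G)"
proof -
  have int: "integrable torus_measure (\<lambda>x. 2 * c\<^sup>2 * (norm (F x))\<^sup>2 + 2 * (norm (G x))\<^sup>2)"
    using F G by simp
  have "(LINT x|torus_measure. (norm (H x))\<^sup>2)
      \<le> (LINT x|torus_measure. 2 * c\<^sup>2 * (norm (F x))\<^sup>2 + 2 * (norm (G x))\<^sup>2)"
  \<comment> \<open>Only the nonnegative majorant has to be integrable, so nothing is asked of
    \<open>H\<close> beyond the almost everywhere identity.\<close>
  proof (rule integral_mono_AE'[OF int])
    show "AE x in torus_measure. (norm (H x))\<^sup>2 \<le> 2 * c\<^sup>2 * (norm (F x))\<^sup>2 + 2 * (norm (G x))\<^sup>2"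
      using H
    proof eventually_elim
      fix x
      assume "H x = c *\<^sub>R F x + G x"
      then have "(norm (H x))\<^sup>2 \<le> (\<bar>c\<bar> * norm (F x) + norm (G x))\<^sup>2"
        using norm_triangle_ineq[of "c *\<^sub>R F x" "G x"] by (intro power_mono) auto
      also have "\<dots> \<le> 2 * c\<^sup>2 * (norm (F x))\<^sup>2 + 2 * (norm (G x))\<^sup>2"
        \<comment> \<open>The factor 2 comes from bounding the square of a sum by twice the sum of
          the squares; it costs only a constant and replaces the Cauchy-Schwarz argument for the
          sharp triangle inequality.\<close>
        using zero_le_power2[of "\<bar>c\<bar> * norm (F x) - norm (G x)"]
        by (simp add: power2_sum power2_diff power_mult_distrib)
      finally show "(norm (H x))\<^sup>2 \<le> 2 * c\<^sup>2 * (norm (F x))\<^sup>2 + 2 * (norm (G x))\<^sup>2" .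
    qed
  qed simp
  then have "(torus_L2_norm H)\<^sup>2 \<le> 2 * (\<bar>c\<bar> * torus_L2_norm F)\<^sup>2 + 2 * (torus_L2_norm G)\<^sup>2"
    using F G by (simp add: torus_L2_norm_square power_mult_distrib)
  also have "\<dots> \<le> (2 * (\<bar>c\<bar> * torus_L2_norm F + torus_L2_norm G))\<^sup>2"
    using torus_L2_norm_nonneg[of F] torus_L2_norm_nonneg[of G]
    by (simp add: power2_sum power_mult_distrib)
  finally show ?thesis
    by (rule power2_le_imp_le) (simp add: torus_L2_norm_nonneg)
qed

text \<open>The two terms on the right must be genuine integrals, since a default value
  \<open>0\<close> there could destroy the bound. Hence both differences are shown to be measurable
  and bounded almost everywhere on the cell.\<close>

lemma torus_L2_norm_grad_diff_le:
  assumes \<epsilon>: "\<epsilon> > 0" and w: "sg_polar_factor \<epsilon> \<rho> \<psi>w"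
    and s: "\<And>x. \<psi>s differentiable (at x)" "continuous_on UNIV (grad \<psi>s)"
    and \<phi>: "continuous_on UNIV (grad \<phi>)"
  shows "torus_L2_norm (\<lambda>x. grad \<psi>w x - grad \<phi> x)
    \<le> 2 * (torus_L2_norm (\<lambda>x. grad (physical_potential \<epsilon> \<psi>w) x - grad (physical_potential \<epsilon> \<psi>s) x) / \<epsilon>
         + torus_L2_norm (\<lambda>x. grad \<psi>s x - grad \<phi> x))"
proof -
  let ?Pw = "physical_potential \<epsilon> \<psi>w" and ?Ps = "physical_potential \<epsilon> \<psi>s"
  \<comment> \<open>Measurability of the weak gradient is part of the push-forward condition in the
    polar factor.\<close>
  have convex: "convex_on UNIV ?Pw" and meas: "grad ?Pw \<in> borel_measurable torus_measure"
    using w by (auto simp: sg_polar_factor_def torus_pushes_to_volume_def)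
  have AE_diff: "AE x in torus_measure. ?Pw differentiable (at x)"
    by (intro AE_torus_measure_if_AE_lborel convex_AE_differentiable convex)
  have grad_Ps: "grad ?Ps = (\<lambda>x. x + \<epsilon> *\<^sub>R grad \<psi>s x)"
    by (intro ext grad_physical_potential s)
  have cont_Ps: "continuous_on UNIV (grad ?Ps)"
    unfolding grad_Ps by (intro continuous_intros s)
  have cont: "continuous_on UNIV (\<lambda>x. grad \<psi>s x - grad \<phi> x)"
    by (intro continuous_intros s \<phi>)
  obtain M1 where M1: "\<And>x. x \<in> torus_cell \<Longrightarrow> ?Pw differentiable (at x) \<Longrightarrow> norm (grad ?Pw x) \<le> M1"
    using convex_grad_bounded[OF convex] by blast
  obtain M2 where M2: "\<And>x. x \<in> torus_cell \<Longrightarrow> norm (grad ?Ps x) \<le> M2"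
    using continuous_bounded_on_torus_cell[OF cont_Ps] by blast
  obtain M3 where M3: "\<And>x. x \<in> torus_cell \<Longrightarrow> norm (grad \<psi>s x - grad \<phi> x) \<le> M3"
    using continuous_bounded_on_torus_cell[OF cont] by blast
  have F: "integrable torus_measure (\<lambda>x. (norm (grad ?Pw x - grad ?Ps x))\<^sup>2)"
  proof (rule torus_integrable_norm_square)
    show "(\<lambda>x. grad ?Pw x - grad ?Ps x) \<in> borel_measurable torus_measure"
      using meas borel_measurable_torus_continuous[OF cont_Ps] by measurable
    show "AE x in torus_measure. norm (grad ?Pw x - grad ?Ps x) \<le> M1 + M2"
      using AE_diff AE_space
    proof eventually_elim
      fix x
      assume "?Pw differentiable (at x)" "x \<in> space torus_measure"
      then show "norm (grad ?Pw x - grad ?Ps x) \<le> M1 + M2"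
        using M1[of x] M2[of x] norm_triangle_ineq4[of "grad ?Pw x" "grad ?Ps x"] by simp
    qed
  qed
  have G: "integrable torus_measure (\<lambda>x. (norm (grad \<psi>s x - grad \<phi> x))\<^sup>2)"
    using M3 by (intro torus_integrable_norm_square[where M = M3] borel_measurable_torus_continuous cont) auto
  have "AE x in torus_measure. grad \<psi>w x - grad \<phi> x =
      (1 / \<epsilon>) *\<^sub>R (grad ?Pw x - grad ?Ps x) + (grad \<psi>s x - grad \<phi> x)"
    using AE_diff
  proof eventually_elim
    fix x
    assume "?Pw differentiable (at x)"
    then have "\<psi>w differentiable (at x)"
      using differentiable_if_physical_potential_differentiable[of \<epsilon> \<psi>w x] \<epsilon> by simp
    from grad_physical_potential[OF this]
    have "grad ?Pw x - grad ?Ps x = \<epsilon> *\<^sub>R (grad \<psi>w x - grad \<psi>s x)"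
      by (simp add: grad_Ps scaleR_diff_right)
    then show "grad \<psi>w x - grad \<phi> x =
        (1 / \<epsilon>) *\<^sub>R (grad ?Pw x - grad ?Ps x) + (grad \<psi>s x - grad \<phi> x)"
      using \<epsilon> by simp
  qed
  from torus_L2_norm_quasi_triangle[OF F G this] show ?thesis
    using \<epsilon> by simp
qed

text \<open>Quantifying \<open>K\<close> before the time, the range of \<open>\<epsilon>\<close> and
  all solutions makes it depend only on \<open>C\<close>, \<open>C1\<close> and \<open>C2\<close>.
  The witness collects the contributions of the weak-strong and the strong error, doubled by the
  weakened triangle inequality.\<close>

theorem theorem7p1:
  fixes C C1 C2 :: real
  shows "\<exists>K::real. \<forall>(T::real) (\<epsilon>0::real)
      (\<rho>bar :: real \<Rightarrow> real^2 \<Rightarrow> real) (\<phi>bar :: real \<Rightarrow> real^2 \<Rightarrow> real)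
      (\<rho>s :: real \<Rightarrow> real \<Rightarrow> real^2 \<Rightarrow> real) (\<psi>s :: real \<Rightarrow> real \<Rightarrow> real^2 \<Rightarrow> real)
      (\<rho>w :: real \<Rightarrow> real \<Rightarrow> real^2 \<Rightarrow> real) (\<psi>w :: real \<Rightarrow> real \<Rightarrow> real^2 \<Rightarrow> real).
    T > 0 \<longrightarrow> \<epsilon>0 > 0 \<longrightarrow>
    euler_solution T \<rho>bar \<phi>bar \<longrightarrow>
    (\<forall>\<epsilon>\<in>{0<..<\<epsilon>0}. sg_prepared_branch \<epsilon> T (\<rho>bar 0) (\<rho>s \<epsilon>) (\<psi>s \<epsilon>)) \<longrightarrow>
    (\<forall>\<epsilon>\<in>{0<..<\<epsilon>0}. \<forall>t\<in>{0..T}.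
       torus_L2_norm (\<lambda>x. grad (\<psi>s \<epsilon> t) x - grad (\<phi>bar t) x) \<le> C1 * \<epsilon>) \<longrightarrow>
    (\<forall>\<epsilon>\<in>{0<..<\<epsilon>0}.
       sg_weak_solution \<epsilon> T (\<rho>w \<epsilon>) (\<psi>w \<epsilon>) \<or> sg_lagrangian_solution \<epsilon> T (\<rho>w \<epsilon>) (\<psi>w \<epsilon>)) \<longrightarrow>
    (\<forall>\<epsilon>\<in>{0<..<\<epsilon>0}. \<forall>t\<in>{0..T}.
       torus_L2_norm (\<lambda>x. grad (physical_potential \<epsilon> (\<psi>w \<epsilon> t)) x
                         - grad (physical_potential \<epsilon> (\<psi>s \<epsilon> t)) x)
       \<le> C2 * torus_L2_norm (\<lambda>x. grad (physical_potential \<epsilon> (\<psi>w \<epsilon> 0)) x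
                                - grad (physical_potential \<epsilon> (\<psi>s \<epsilon> 0)) x)) \<longrightarrow>
    (\<forall>\<epsilon>\<in>{0<..<\<epsilon>0}.
       torus_L2_norm (\<lambda>x. grad (physical_potential \<epsilon> (\<psi>w \<epsilon> 0)) x
                         - grad (physical_potential \<epsilon> (\<psi>s \<epsilon> 0)) x) \<le> C * \<epsilon>\<^sup>2) \<longrightarrow>
    (\<forall>\<epsilon>\<in>{0<..<\<epsilon>0}. \<forall>t\<in>{0..T}.
       torus_L2_norm (\<lambda>x. grad (\<psi>w \<epsilon> t) x - grad (\<phi>bar t) x) \<le> K * \<epsilon>)"
proof (rule exI[of _ "2 * (\<bar>C2\<bar> * \<bar>C\<bar> + \<bar>C1\<bar>)"], intro allI impI ballI)
  fix T \<epsilon>0 :: real and \<rho>bar \<phi>bar :: "real \<Rightarrow> real^2 \<Rightarrow> real"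
    and \<rho>s \<psi>s \<rho>w \<psi>w :: "real \<Rightarrow> real \<Rightarrow> real^2 \<Rightarrow> real" and \<epsilon> t :: real
  let ?P = "physical_potential \<epsilon>"
  let ?d = "\<lambda>t. torus_L2_norm (\<lambda>x. grad (?P (\<psi>w \<epsilon> t)) x - grad (?P (\<psi>s \<epsilon> t)) x)"
  let ?e = "torus_L2_norm (\<lambda>x. grad (\<psi>s \<epsilon> t) x - grad (\<phi>bar t) x)"
  assume euler: "euler_solution T \<rho>bar \<phi>bar"
    and branch: "\<forall>\<epsilon>\<in>{0<..<\<epsilon>0}. sg_prepared_branch \<epsilon> T (\<rho>bar 0) (\<rho>s \<epsilon>) (\<psi>s \<epsilon>)"
    and strong: "\<forall>\<epsilon>\<in>{0<..<\<epsilon>0}. \<forall>t\<in>{0..T}.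
       torus_L2_norm (\<lambda>x. grad (\<psi>s \<epsilon> t) x - grad (\<phi>bar t) x) \<le> C1 * \<epsilon>"
    and weak: "\<forall>\<epsilon>\<in>{0<..<\<epsilon>0}.
       sg_weak_solution \<epsilon> T (\<rho>w \<epsilon>) (\<psi>w \<epsilon>) \<or> sg_lagrangian_solution \<epsilon> T (\<rho>w \<epsilon>) (\<psi>w \<epsilon>)"
    and stable: "\<forall>\<epsilon>\<in>{0<..<\<epsilon>0}. \<forall>t\<in>{0..T}.
       torus_L2_norm (\<lambda>x. grad (physical_potential \<epsilon> (\<psi>w \<epsilon> t)) x
                         - grad (physical_potential \<epsilon> (\<psi>s \<epsilon> t)) x)
       \<le> C2 * torus_L2_norm (\<lambda>x. grad (physical_potential \<epsilon> (\<psi>w \<epsilon> 0)) x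
                                - grad (physical_potential \<epsilon> (\<psi>s \<epsilon> 0)) x)"
    and initial: "\<forall>\<epsilon>\<in>{0<..<\<epsilon>0}.
       torus_L2_norm (\<lambda>x. grad (physical_potential \<epsilon> (\<psi>w \<epsilon> 0)) x
                         - grad (physical_potential \<epsilon> (\<psi>s \<epsilon> 0)) x) \<le> C * \<epsilon>\<^sup>2"
    and \<epsilon>_range: "\<epsilon> \<in> {0<..<\<epsilon>0}" and t: "t \<in> {0..T}"
  have \<epsilon>: "\<epsilon> > 0"
    using \<epsilon>_range by simp
  have s: "smooth_torus_path T (\<psi>s \<epsilon>)"
    using branch \<epsilon>_range by (auto simp: sg_prepared_branch_def sg_smooth_solution_def)
  have \<phi>: "smooth_torus_path T \<phi>bar"
    using euler by (simp add: euler_solution_def)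
  have "sg_weak_solution \<epsilon> T (\<rho>w \<epsilon>) (\<psi>w \<epsilon>) \<or> sg_lagrangian_solution \<epsilon> T (\<rho>w \<epsilon>) (\<psi>w \<epsilon>)"
    using weak \<epsilon>_range by blast
  then have w: "sg_polar_factor \<epsilon> (\<rho>w \<epsilon> t) (\<psi>w \<epsilon> t)"
    using t by (auto simp: sg_weak_solution_def sg_lagrangian_solution_def sg_state_def)
  \<comment> \<open>Absolute values enter because the constants carry no sign assumption.\<close>
  have "?d t \<le> C2 * ?d 0"
    using stable \<epsilon>_range t by simp
  also have "\<dots> \<le> \<bar>C2\<bar> * ?d 0"
    by (intro mult_right_mono torus_L2_norm_nonneg) simp
  also have "\<dots> \<le> \<bar>C2\<bar> * (\<bar>C\<bar> * \<epsilon>\<^sup>2)"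
  proof (intro mult_left_mono)
    have "?d 0 \<le> C * \<epsilon>\<^sup>2"
      using initial \<epsilon>_range by simp
    also have "\<dots> \<le> \<bar>C\<bar> * \<epsilon>\<^sup>2"
      by (intro mult_right_mono) auto
    finally show "?d 0 \<le> \<bar>C\<bar> * \<epsilon>\<^sup>2" .
  qed simp
  finally have d: "?d t / \<epsilon> \<le> \<bar>C2\<bar> * \<bar>C\<bar> * \<epsilon>"
    using \<epsilon> by (simp add: field_simps power2_eq_square)
  have "?e \<le> C1 * \<epsilon>"
    using strong \<epsilon>_range t by simp
  also have "\<dots> \<le> \<bar>C1\<bar> * \<epsilon>"
    using \<epsilon> by (intro mult_right_mono) auto
  finally have e: "?e \<le> \<bar>C1\<bar> * \<epsilon>" .
  have "torus_L2_norm (\<lambda>x. grad (\<psi>w \<epsilon> t) x - grad (\<phi>bar t) x) \<le> 2 * (?d t / \<epsilon> + ?e)"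
    by (rule torus_L2_norm_grad_diff_le[OF \<epsilon> w smooth_torus_path_slice[OF s t]
          smooth_torus_path_slice(2)[OF \<phi> t]])
  also have "\<dots> \<le> 2 * (\<bar>C2\<bar> * \<bar>C\<bar> + \<bar>C1\<bar>) * \<epsilon>"
    using d e by (simp add: algebra_simps)
  finally show "torus_L2_norm (\<lambda>x. grad (\<psi>w \<epsilon> t) x - grad (\<phi>bar t) x)
      \<le> 2 * (\<bar>C2\<bar> * \<bar>C\<bar> + \<bar>C1\<bar>) * \<epsilon>" .
qed

end
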